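(* Let $\beta=(\beta_n)_{n\ge0}$ be a sequence of positive numbers which is bounded above and slowly oscillating. Then every symbol $\phi$ that extends analytically to a neighborhood of the closed unit disk $\overline{\mathbb D}$ induces a bounded composition operator $C_\phi$ on $H^2(\beta)$.
   Context: $H^2(\beta)$ is the Hilbert space of analytic functions $f(z)=\sum_{n\ge0}a_nz^n$ on the unit disk $\mathbb D$ with $\|f\|^2=\sum_{n\ge0}|a_n|^2\beta_n<\infty$. A symbol is a non-constant analytic map $\phi:\mathbb D\to\mathbb D$ and $C_\phi f=f\circ\phi$. $\beta$ is slowly oscillating if there are constants $0<C_1<C_2$ with $C_1\le\beta_m/\beta_n\le C_2$ whenever $n\ge1$ and $n/2\le m\le2n$. *)

theory Defs
  imports "HOL-Complex_Analysis.Complex_Analysis"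
begin

definition taylor_coeff :: "(complex \<Rightarrow> complex) \<Rightarrow> nat \<Rightarrow> complex" where
  "taylor_coeff f n = (deriv ^^ n) f 0 / fact n"

definition H2 :: "(nat \<Rightarrow> real) \<Rightarrow> (complex \<Rightarrow> complex) set" where
  "H2 \<beta> = {f. f holomorphic_on ball 0 1 \<and>
                summable (\<lambda>n. (norm (taylor_coeff f n))\<^sup>2 * \<beta> n)}"

definition H2_norm :: "(nat \<Rightarrow> real) \<Rightarrow> (complex \<Rightarrow> complex) \<Rightarrow> real" where
  "H2_norm \<beta> f = sqrt (\<Sum>n. (norm (taylor_coeff f n))\<^sup>2 * \<beta> n)"

definition slowly_oscillating :: "(nat \<Rightarrow> real) \<Rightarrow> bool" where
  "slowly_oscillating \<beta> \<longleftrightarrow> (\<exists>C1 C2. 0 < C1 \<and> C1 < C2 \<and>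
     (\<forall>n m. n \<ge> 1 \<and> real n / 2 \<le> real m \<and> real m \<le> 2 * real n \<longrightarrow>
        C1 \<le> \<beta> m / \<beta> n \<and> \<beta> m / \<beta> n \<le> C2))"

definition symbol :: "(complex \<Rightarrow> complex) \<Rightarrow> bool" where
  "symbol \<phi> \<longleftrightarrow> \<phi> holomorphic_on ball 0 1 \<and> \<phi> ` ball 0 1 \<subseteq> ball 0 1 \<and>
     \<not> (\<exists>c. \<forall>z\<in>ball 0 1. \<phi> z = c)"

definition bounded_composition :: "(nat \<Rightarrow> real) \<Rightarrow> (complex \<Rightarrow> complex) \<Rightarrow> bool" where
  "bounded_composition \<beta> \<phi> \<longleftrightarrow>
     (\<forall>f\<in>H2 \<beta>. f \<circ> \<phi> \<in> H2 \<beta>) \<and>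
     (\<exists>C. \<forall>f\<in>H2 \<beta>. H2_norm \<beta> (f \<circ> \<phi>) \<le> C * H2_norm \<beta> f)"

end

theory Submission
  imports Defs
begin

text \<open>In the matrix \<open>a m n\<close> of the composition operator (the \<open>m\<close>-th Taylor coefficient of the
  \<open>n\<close>-th power of the symbol), Cauchy's estimates on circles of radius \<open>R > 1\<close> and \<open>1/2\<close> make the
  entries with \<open>m \<ge> Q * n\<close> or \<open>n \<ge> Q * m\<close> exponentially small in \<open>m + n\<close>. These entries are
  harmless, since a slowly oscillating weight decays at most polynomially. For \<open>m\<close> in a dyadic block,
  the remaining \<open>n\<close> are comparable to \<open>m\<close>, so the weight is constant there up to a factor and
  Littlewood's bound on the unweighted Hardy space applies; every \<open>n\<close> occurs for boundedly many
  blocks, so the block estimates add up.\<close>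

section \<open>Taylor coefficients\<close>

text \<open>Derivatives at 0 depend only on the germ there; this later lets the analytic extension
  replace the symbol.\<close>

lemma taylor_coeff_cong:
  assumes "\<And>z. z \<in> ball 0 1 \<Longrightarrow> f z = g z"
  shows "taylor_coeff f n = taylor_coeff g n"
proof -
  have "eventually (\<lambda>z. f z = g z) (nhds 0)"
    using assms by (intro eventually_nhds_in_open[of "ball 0 1", THEN eventually_mono]) auto
  then show ?thesis
    unfolding taylor_coeff_def by (simp add: higher_deriv_cong_ev)
qed

lemma taylor_coeff_const: "taylor_coeff (\<lambda>z. c) n = (if n = 0 then c else 0)"
  by (simp add: taylor_coeff_def)

lemma taylor_coeff_power: "taylor_coeff (\<lambda>z. z ^ n) k = (if n = k then 1 else 0)"
  using higher_deriv_power[of k 0 n 0]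
  by (cases n k rule: linorder_cases) (auto simp: taylor_coeff_def pochhammer_0_left pochhammer_fact[symmetric])

lemma taylor_coeff_diff:
  assumes "f holomorphic_on ball 0 1" "g holomorphic_on ball 0 1"
  shows "taylor_coeff (\<lambda>z. f z - g z) n = taylor_coeff f n - taylor_coeff g n"
  using higher_deriv_diff[OF assms] by (simp add: taylor_coeff_def diff_divide_distrib)

lemma taylor_coeff_cmult:
  assumes "f holomorphic_on ball 0 1"
  shows "taylor_coeff (\<lambda>z. c * f z) n = c * taylor_coeff f n"
  using higher_deriv_cmult[OF assms] by (simp add: taylor_coeff_def)

lemma taylor_coeff_sum:
  assumes "finite A" "\<And>i. i \<in> A \<Longrightarrow> f i holomorphic_on ball 0 1"
  shows "taylor_coeff (\<lambda>z. \<Sum>i\<in>A. c i * f i z) n = (\<Sum>i\<in>A. c i * taylor_coeff (f i) n)"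
  using assms
proof (induction A rule: finite_induct)
  case empty
  then show ?case by (simp add: taylor_coeff_const)
next
  case (insert i A)
  have "(deriv ^^ n) (\<lambda>z. c i * f i z + (\<Sum>i\<in>A. c i * f i z)) 0
      = (deriv ^^ n) (\<lambda>z. c i * f i z) 0 + (deriv ^^ n) (\<lambda>z. \<Sum>i\<in>A. c i * f i z) 0"
    by (rule higher_deriv_add[where S = "ball 0 1"]) (use insert in \<open>auto intro!: holomorphic_intros\<close>)
  then have "taylor_coeff (\<lambda>z. \<Sum>i\<in>insert i A. c i * f i z) n
      = taylor_coeff (\<lambda>z. c i * f i z) n + taylor_coeff (\<lambda>z. \<Sum>i\<in>A. c i * f i z) n"
    using insert by (simp add: taylor_coeff_def add_divide_distrib)
  then show ?case
    using insert by (simp add: taylor_coeff_cmult)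
qed

lemma norm_taylor_coeff_le:
  assumes "f holomorphic_on cball 0 \<rho>" "0 < \<rho>" "\<And>z. norm z = \<rho> \<Longrightarrow> norm (f z) \<le> B"
  shows "norm (taylor_coeff f n) \<le> B / \<rho> ^ n"
proof -
  have "norm ((deriv ^^ n) f 0) \<le> fact n * B / \<rho> ^ n"
    by (rule Cauchy_inequality)
      (use assms in \<open>auto intro: holomorphic_on_subset holomorphic_on_imp_continuous_on\<close>)
  then have "norm ((deriv ^^ n) f 0) / fact n \<le> (fact n * B / \<rho> ^ n) / fact n"
    by (rule divide_right_mono) simp
  then show ?thesis
    by (simp add: taylor_coeff_def norm_divide)
qed

text \<open>Cauchy's formula for derivatives on the unit circle, read as a Fourier coefficient. The
  case \<open>k = 0\<close> is the mean value property.\<close>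

lemma has_integral_taylor_coeff:
  assumes "f holomorphic_on cball 0 1"
  shows "((\<lambda>t. f (cis (2*pi*t)) * cnj (cis (2*pi*t)) ^ k) has_integral taylor_coeff f k) {0..1}"
proof -
  have "((\<lambda>u. f u / (u-0) ^ (Suc k)) has_contour_integral ((2 * pi * \<i>) / (fact k) * (deriv ^^ k) f 0))
           (circlepath 0 1)"
    by (rule Cauchy_has_contour_integral_higher_derivative_circlepath)
      (use assms in \<open>auto intro: holomorphic_on_subset holomorphic_on_imp_continuous_on\<close>)
  then have "((\<lambda>u. f u / (u-0) ^ (Suc k)) has_contour_integral (2 * pi * \<i> * taylor_coeff f k))
           (circlepath 0 1)"
    by (simp add: taylor_coeff_def)
  moreover have "circlepath 0 1 t = cis (2*pi*t)"
    "vector_derivative (circlepath 0 1) (at t) = 2 * pi * \<i> * cis (2*pi*t)" for t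
    unfolding vector_derivative_circlepath by (simp_all add: circlepath cis_conv_exp mult_ac)
  ultimately have "((\<lambda>t. f (cis (2*pi*t)) / cis (2*pi*t) ^ Suc k * (2 * pi * \<i> * cis (2*pi*t)))
      has_integral (2 * pi * \<i> * taylor_coeff f k)) {0..1}"
    by (simp add: has_contour_integral)
  from has_integral_mult_right[OF this, of "1 / (2 * pi * \<i>)"]
  have "((\<lambda>t. f (cis (2*pi*t)) / cis (2*pi*t) ^ k) has_integral taylor_coeff f k) {0..1}"
    by (simp add: field_simps)
  \<comment> \<open>On the unit circle the inverse is the conjugate.\<close>
  moreover have "f (cis (2*pi*t)) / cis (2*pi*t) ^ k = f (cis (2*pi*t)) * cnj (cis (2*pi*t)) ^ k" for t
    by (simp add: divide_inverse cis_cnj flip: cis_inverse power_inverse)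
  ultimately show ?thesis by simp
qed

lemma integrable_on_circle:
  fixes h :: "complex \<Rightarrow> 'a :: euclidean_space"
  assumes "continuous_on (cball 0 1) h"
  shows "(\<lambda>t. h (cis (2*pi*t))) integrable_on {0..1}"
  by (intro integrable_continuous_real continuous_on_compose2[OF assms] continuous_intros) auto

text \<open>Let \<open>p\<close> be the Taylor polynomial with the terms below \<open>N\<close>. The
  pairings of \<open>f\<close> with \<open>p\<close> and of \<open>p\<close> with itself both equal
  the coefficient sum \<open>S\<close>, so nonnegativity of the mean square of \<open>f - p\<close>
  gives the claim.\<close>

lemma Bessel_inequality_circle:
  assumes "f holomorphic_on cball 0 1"
  shows "(\<Sum>m<N. (norm (taylor_coeff f m))\<^sup>2) \<le> integral {0..1} (\<lambda>t. (norm (f (cis (2*pi*t))))\<^sup>2)"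
proof -
  define p where "p = (\<lambda>z. \<Sum>m<N. taylor_coeff f m * z ^ m)"
  have hp: "p holomorphic_on A" for A
    unfolding p_def by (intro holomorphic_intros)
  have tp: "taylor_coeff p k = taylor_coeff f k" if "k < N" for k
    using that unfolding p_def
    by (subst taylor_coeff_sum) (auto intro!: holomorphic_intros simp: taylor_coeff_power if_distrib cong: if_cong)
  define S where "S = (\<Sum>m<N. (norm (taylor_coeff f m))\<^sup>2)"
  \<comment> \<open>Used for \<open>g = f\<close> and for \<open>g = p\<close>: only coefficients
    below \<open>N\<close> enter the pairing with \<open>p\<close>.\<close>
  have pair: "((\<lambda>t. g (cis (2*pi*t)) * cnj (p (cis (2*pi*t)))) has_integral complex_of_real S) {0..1}"
    if g: "g holomorphic_on cball 0 1" "\<And>k. k < N \<Longrightarrow> taylor_coeff g k = taylor_coeff f k" for g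
  proof -
    have "((\<lambda>t. \<Sum>k<N. cnj (taylor_coeff f k) * (g (cis (2*pi*t)) * cnj (cis (2*pi*t)) ^ k))
        has_integral (\<Sum>k<N. cnj (taylor_coeff f k) * taylor_coeff g k)) {0..1}"
      by (intro has_integral_sum has_integral_mult_right has_integral_taylor_coeff g) auto
    moreover have "(\<Sum>k<N. cnj (taylor_coeff f k) * taylor_coeff g k) = complex_of_real S"
      using g(2) unfolding S_def of_real_sum complex_norm_square by (simp add: mult.commute)
    ultimately show ?thesis
      by (simp add: p_def sum_distrib_left mult_ac)
  qed
  have fp: "((\<lambda>t. Re (f (cis (2*pi*t)) * cnj (p (cis (2*pi*t))))) has_integral S) {0..1}"
    using has_integral_Re[OF pair[OF assms]] by simp
  have pp: "((\<lambda>t. Re (p (cis (2*pi*t)) * cnj (p (cis (2*pi*t))))) has_integral S) {0..1}"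
    using has_integral_Re[OF pair[OF hp tp]] by simp
  have cont: "continuous_on (cball 0 1) f"
    using assms by (rule holomorphic_on_imp_continuous_on)
  have ff: "((\<lambda>t. (norm (f (cis (2*pi*t))))\<^sup>2) has_integral integral {0..1} (\<lambda>t. (norm (f (cis (2*pi*t))))\<^sup>2)) {0..1}"
    by (intro integrable_integral integrable_on_circle[where h = "\<lambda>z. (norm (f z))\<^sup>2"] continuous_intros cont)
  have "((\<lambda>t. (norm (f (cis (2*pi*t)) - p (cis (2*pi*t))))\<^sup>2) has_integral
      (integral {0..1} (\<lambda>t. (norm (f (cis (2*pi*t))))\<^sup>2) - 2 * S + S)) {0..1}"
  proof (rule has_integral_eq[OF _ has_integral_add[OF has_integral_diff[OF ff has_integral_mult_right[OF fp, of 2]] pp]])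
    show "(cmod (f (cis (2 * pi * t))))\<^sup>2 - 2 * Re (f (cis (2 * pi * t)) * cnj (p (cis (2 * pi * t)))) +
         Re (p (cis (2 * pi * t)) * cnj (p (cis (2 * pi * t)))) =
         (cmod (f (cis (2 * pi * t)) - p (cis (2 * pi * t))))\<^sup>2" for t
      by (simp only: cmod_power2) (simp add: algebra_simps power2_eq_square)
  qed
  then have "0 \<le> integral {0..1} (\<lambda>t. (norm (f (cis (2*pi*t))))\<^sup>2) - 2 * S + S"
    by (rule has_integral_nonneg) auto
  then show ?thesis by (simp add: S_def)
qed

section \<open>Littlewood subordination for polynomials\<close>

text \<open>On the closed disk, \<open>Re (majorant N a w)\<close> is the Poisson extension of \<open>\<bar>\<Sum>n<N. a n * w ^ n\<bar>\<^sup>2\<close>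
  from the unit circle, written as the real part of a polynomial so that it stays harmonic under
  composition with a holomorphic map.\<close>

primrec majorant :: "nat \<Rightarrow> (nat \<Rightarrow> complex) \<Rightarrow> complex \<Rightarrow> complex" where
  "majorant 0 a w = 0"
| "majorant (Suc N) a w = (norm (a 0))\<^sup>2
     + 2 * cnj (a 0) * w * (\<Sum>n<N. a (Suc n) * w ^ n) + majorant N (\<lambda>n. a (Suc n)) w"

lemma holomorphic_on_majorant [holomorphic_intros]:
  "f holomorphic_on A \<Longrightarrow> (\<lambda>z. majorant N a (f z)) holomorphic_on A"
  by (induction N arbitrary: a) (auto intro!: holomorphic_intros)

text \<open>Splitting off \<open>a 0\<close> produces exactly the cross term built into
  \<open>majorant\<close>. The only loss in the induction is the factor \<open>norm w\<close> in
  \<open>norm (w * p)\<close>, so equality holds on the unit circle.\<close>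

lemma norm_poly_square_le_majorant:
  assumes "norm w \<le> 1"
  shows "(norm (\<Sum>n<N. a n * w ^ n))\<^sup>2 \<le> Re (majorant N a w)"
proof (induction N arbitrary: a)
  case (Suc N)
  define p where "p = (\<Sum>n<N. a (Suc n) * w ^ n)"
  have split: "(\<Sum>n<Suc N. a n * w ^ n) = a 0 + w * p"
    unfolding sum.lessThan_Suc_shift by (simp add: p_def sum_distrib_left mult_ac)
  have "(norm (a 0 + w * p))\<^sup>2 = (norm (a 0))\<^sup>2 + Re (2 * cnj (a 0) * w * p) + (norm (w * p))\<^sup>2"
    by (simp only: cmod_power2) (simp add: algebra_simps power2_eq_square)
  also have "(norm (w * p))\<^sup>2 \<le> (norm p)\<^sup>2"
    using assms by (simp add: norm_mult mult_left_le_one_le power_mono)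
  also have "(norm p)\<^sup>2 \<le> Re (majorant N (\<lambda>n. a (Suc n)) w)"
    unfolding p_def by (rule Suc)
  finally show ?case
    by (simp only: split majorant.simps plus_complex.sel flip: p_def) (simp flip: of_real_power)
qed simp

text \<open>The subtracted term makes the induction work: the weight of each coefficient grows by
  \<open>r ^ Suc n\<close> under the shift, which pays for its products with the new constant term.\<close>

lemma norm_majorant_le_aux:
  assumes "norm w \<le> r" "r < 1"
  shows "norm (majorant N a w) \<le> (\<Sum>n<N. (norm (a n))\<^sup>2 * ((1 + r) / (1 - r) - r ^ Suc n / (1 - r)))"
proof (induction N arbitrary: a)
  case (Suc N)
  have r: "0 \<le> r" using assms norm_ge_zero[of w] by linarith
  \<comment> \<open>Shares each cross product between the square of \<open>a 0\<close> and that of a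
    shifted coefficient.\<close>
  have young: "2 * (x * y) \<le> x\<^sup>2 + y\<^sup>2" for x y :: real
    using sum_squares_bound[of x y] by (simp add: mult_ac)
  have "norm (2 * cnj (a 0) * w * (\<Sum>n<N. a (Suc n) * w ^ n))
      = norm (\<Sum>n<N. 2 * (cnj (a 0) * a (Suc n)) * w ^ Suc n)"
    by (simp add: sum_distrib_left mult_ac)
  also have "\<dots> \<le> (\<Sum>n<N. r ^ Suc n * ((norm (a 0))\<^sup>2 + (norm (a (Suc n)))\<^sup>2))"
  proof (rule sum_norm_le)
    fix n
    have "norm (2 * (cnj (a 0) * a (Suc n)) * w ^ Suc n)
        = norm w ^ Suc n * (2 * (norm (a 0) * norm (a (Suc n))))"
      by (simp add: norm_mult norm_power mult_ac)
    also have "\<dots> \<le> r ^ Suc n * ((norm (a 0))\<^sup>2 + (norm (a (Suc n)))\<^sup>2)"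
      by (intro mult_mono power_mono young) (use assms r in auto)
    finally show "norm (2 * (cnj (a 0) * a (Suc n)) * w ^ Suc n) \<le> \<dots>" .
  qed
  also have "\<dots> = (norm (a 0))\<^sup>2 * (\<Sum>n<N. r ^ Suc n) + (\<Sum>n<N. (norm (a (Suc n)))\<^sup>2 * r ^ Suc n)"
    by (simp add: sum.distrib algebra_simps sum_distrib_left)
  also have "(\<Sum>n<N. r ^ Suc n) \<le> r / (1 - r)"
  proof -
    have "(\<Sum>n<N. r ^ Suc n) = r * (\<Sum>n<N. r ^ n)" by (simp add: sum_distrib_left)
    also have "(\<Sum>n<N. r ^ n) \<le> 1 / (1 - r)"
      using sum_le_suminf[of "\<lambda>n. r ^ n" "{..<N}"] r assms by (auto simp: suminf_geometric summable_geometric)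
    finally show ?thesis using r by (simp add: mult_left_mono)
  qed
  finally have 1: "norm (2 * cnj (a 0) * w * (\<Sum>n<N. a (Suc n) * w ^ n))
      \<le> (norm (a 0))\<^sup>2 * (r / (1 - r)) + (\<Sum>n<N. (norm (a (Suc n)))\<^sup>2 * r ^ Suc n)"
    by (simp add: mult_left_mono)
  have "norm (majorant (Suc N) a w) \<le> (norm (a 0))\<^sup>2
      + norm (2 * cnj (a 0) * w * (\<Sum>n<N. a (Suc n) * w ^ n)) + norm (majorant N (\<lambda>n. a (Suc n)) w)"
    unfolding majorant.simps
    by (intro order.trans[OF norm_triangle_ineq] add_mono order.refl) (simp flip: of_real_power)
  also have "\<dots> \<le> (norm (a 0))\<^sup>2 * (1 + r / (1 - r)) + (\<Sum>n<N. (norm (a (Suc n)))\<^sup>2 * r ^ Suc n)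
      + (\<Sum>n<N. (norm (a (Suc n)))\<^sup>2 * ((1 + r) / (1 - r) - r ^ Suc n / (1 - r)))"
    using 1 Suc[of "\<lambda>n. a (Suc n)"] by (simp add: algebra_simps)
  also have "\<dots> = (\<Sum>n<Suc N. (norm (a n))\<^sup>2 * ((1 + r) / (1 - r) - r ^ Suc n / (1 - r)))"
  proof -
    \<comment> \<open>As \<open>r ^ Suc n\<close> is a difference of consecutive terms
      \<open>r ^ k / (1 - r)\<close>, adding the cross term's share turns the weight of index
      \<open>n\<close> into that of index \<open>Suc n\<close>.\<close>
    have e: "x * r ^ Suc n + x * ((1 + r) / (1 - r) - r ^ Suc n / (1 - r))
        = x * ((1 + r) / (1 - r) - r ^ Suc (Suc n) / (1 - r))" for x n
    proof -
      have "r ^ Suc n = r ^ Suc n / (1 - r) - r ^ Suc (Suc n) / (1 - r)"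
        using assms by (simp add: divide_simps) (simp add: algebra_simps)
      then have "x * r ^ Suc n = x * (r ^ Suc n / (1 - r) - r ^ Suc (Suc n) / (1 - r))" by simp
      then show ?thesis by (simp only: right_diff_distrib)
    qed
    have "1 + r / (1 - r) = (1 + r) / (1 - r) - r ^ Suc 0 / (1 - r)"
      using assms by (simp add: field_simps)
    then show ?thesis
      unfolding sum.lessThan_Suc_shift e[symmetric] by (simp add: sum.distrib)
  qed
  finally show ?case .
qed simp

text \<open>Take \<open>r = norm w\<close> and discard the subtracted term. The constant is the
  maximum over the circle of the Poisson kernel at \<open>w\<close>, as in Harnack's
  inequality.\<close>

lemma norm_majorant_le:
  assumes "norm w < 1"
  shows "norm (majorant N a w) \<le> (1 + norm w) / (1 - norm w) * (\<Sum>n<N. (norm (a n))\<^sup>2)"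
proof -
  have "norm (majorant N a w) \<le>
      (\<Sum>n<N. (norm (a n))\<^sup>2 * ((1 + norm w) / (1 - norm w) - norm w ^ Suc n / (1 - norm w)))"
    using assms by (intro norm_majorant_le_aux) auto
  also have "\<dots> \<le> (\<Sum>n<N. (norm (a n))\<^sup>2 * ((1 + norm w) / (1 - norm w)))"
    using assms by (intro sum_mono mult_left_mono) auto
  finally show ?thesis by (simp add: sum_distrib_left mult.commute)
qed

text \<open>Bessel's inequality passes to the circle, where the majorant at \<open>g\<close>
  dominates the square of the polynomial in \<open>g\<close>. Being holomorphic in \<open>z\<close>,
  the composed majorant has its value at \<open>z = 0\<close> as circle mean, and the Harnack-type
  bound applies at \<open>g 0\<close>.\<close>

lemma Littlewood_subordination:
  assumes g: "g holomorphic_on cball 0 1" "g ` cball 0 1 \<subseteq> cball 0 1" and g0: "norm (g 0) < 1"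
  shows "(\<Sum>m<M. (norm (taylor_coeff (\<lambda>z. \<Sum>n<N. a n * g z ^ n) m))\<^sup>2)
    \<le> (1 + norm (g 0)) / (1 - norm (g 0)) * (\<Sum>n<N. (norm (a n))\<^sup>2)"
proof -
  have hF: "(\<lambda>z. majorant N a (g z)) holomorphic_on cball 0 1"
    by (intro holomorphic_intros g)
  have hp: "(\<lambda>z. \<Sum>n<N. a n * g z ^ n) holomorphic_on cball 0 1"
    by (intro holomorphic_intros g)
  have F0: "((\<lambda>t. majorant N a (g (cis (2*pi*t)))) has_integral majorant N a (g 0)) {0..1}"
    using has_integral_taylor_coeff[OF hF, of 0] by (simp add: taylor_coeff_def)
  have "(\<Sum>m<M. (norm (taylor_coeff (\<lambda>z. \<Sum>n<N. a n * g z ^ n) m))\<^sup>2)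
      \<le> integral {0..1} (\<lambda>t. (norm (\<Sum>n<N. a n * g (cis (2*pi*t)) ^ n))\<^sup>2)"
    by (rule Bessel_inequality_circle[OF hp])
  also have "\<dots> \<le> Re (majorant N a (g 0))"
  proof (rule integral_le[where g = "\<lambda>t. Re (majorant N a (g (cis (2*pi*t))))", THEN order.trans])
    show "(\<lambda>t. (norm (\<Sum>n<N. a n * g (cis (2*pi*t)) ^ n))\<^sup>2) integrable_on {0..1}"
      by (intro integrable_on_circle[where h = "\<lambda>z. (norm (\<Sum>n<N. a n * g z ^ n))\<^sup>2"]
          continuous_intros holomorphic_on_imp_continuous_on g)
    show "(\<lambda>t. Re (majorant N a (g (cis (2*pi*t))))) integrable_on {0..1}"
      using has_integral_Re[OF F0] by blast
    show "(norm (\<Sum>n<N. a n * g (cis (2*pi*t)) ^ n))\<^sup>2 \<le> Re (majorant N a (g (cis (2*pi*t))))" for t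
    proof (rule norm_poly_square_le_majorant)
      have "g (cis (2*pi*t)) \<in> g ` cball 0 1" by (intro imageI) auto
      with g(2) have "g (cis (2*pi*t)) \<in> cball 0 1" by (rule subsetD)
      then show "norm (g (cis (2*pi*t))) \<le> 1" by simp
    qed
    show "integral {0..1} (\<lambda>t. Re (majorant N a (g (cis (2*pi*t))))) \<le> Re (majorant N a (g 0))"
      using integral_unique[OF has_integral_Re[OF F0]] by simp
  qed
  also have "\<dots> \<le> norm (majorant N a (g 0))" by (rule complex_Re_le_cmod)
  also have "\<dots> \<le> (1 + norm (g 0)) / (1 - norm (g 0)) * (\<Sum>n<N. (norm (a n))\<^sup>2)"
    by (rule norm_majorant_le[OF g0])
  finally show ?thesis .
qed

text \<open>Half of the decay, \<open>sqrt r ^ n\<close>, absorbs the polynomial, because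
  \<open>n * s ^ n\<close> tends to 0 for \<open>s < 1\<close>; the other half is a summable
  majorant.\<close>

lemma summable_power_times_geometric:
  assumes "0 < r" "r < (1::real)"
  shows "summable (\<lambda>n. real n ^ A * r ^ n)"
proof (rule summable_comparison_test_ev)
  \<comment> \<open>Order \<open>Suc A\<close> instead of \<open>A\<close> keeps \<open>s\<close>
    strictly between 0 and 1 even for \<open>A = 0\<close>.\<close>
  define s where "s = root (Suc A) (sqrt r)"
  have s: "0 < s" "s < 1" using assms by (auto simp: s_def)
  have sA: "s ^ A \<ge> sqrt r"
  proof -
    have "sqrt r = s ^ Suc A" using assms unfolding s_def by (subst real_root_pow_pos2) auto
    also have "\<dots> \<le> s ^ A" using s by (intro power_decreasing) auto
    finally show ?thesis .
  qed
  show "summable (\<lambda>n. sqrt r ^ n)" using assms by (simp add: summable_geometric)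
  have "(\<lambda>n. real n * s ^ n) \<longlonglongrightarrow> 0"
    using powser_times_n_limit_0[of s] s by simp
  then have "eventually (\<lambda>n. real n * s ^ n < 1) sequentially"
    by (rule order_tendstoD) simp
  then show "\<forall>\<^sub>F n in sequentially. norm (real n ^ A * r ^ n) \<le> sqrt r ^ n"
  proof eventually_elim
    case (elim n)
    have "real n ^ A * sqrt r ^ n \<le> real n ^ A * (s ^ A) ^ n"
      using sA assms by (intro mult_left_mono power_mono) auto
    also have "\<dots> = (real n * s ^ n) ^ A"
      by (simp add: power_mult_distrib mult.commute flip: power_mult)
    also have "\<dots> \<le> 1"
      using elim s by (intro power_le_one) auto
    finally have "(real n ^ A * sqrt r ^ n) * sqrt r ^ n \<le> 1 * sqrt r ^ n"
      using assms by (intro mult_right_mono) auto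
    moreover have "r ^ n = sqrt r ^ n * sqrt r ^ n"
      using assms by (simp flip: power_mult_distrib)
    ultimately show ?case using assms by (simp add: mult_ac)
  qed
qed

section \<open>Slowly oscillating weights\<close>

text \<open>Iterates the one-step comparison: \<open>m\<close> moves towards \<open>n\<close> by
  factors of at most 2, and each move costs a factor \<open>D\<close>.\<close>

lemma slowly_oscillating_comparison:
  assumes pos: "\<And>n. \<beta> n > 0" and osc: "slowly_oscillating \<beta>"
  obtains D where "D \<ge> 1"
    "\<And>k m n. 1 \<le> m \<Longrightarrow> 1 \<le> n \<Longrightarrow> n \<le> 2 ^ k * m \<Longrightarrow> m \<le> 2 ^ k * n \<Longrightarrow> \<beta> m \<le> D ^ k * \<beta> n"
proof -
  obtain C where C: "\<And>n m. n \<ge> 1 \<Longrightarrow> real n / 2 \<le> real m \<Longrightarrow> real m \<le> 2 * real n \<Longrightarrow> \<beta> m / \<beta> n \<le> C"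
    using osc unfolding slowly_oscillating_def by blast
  define D where "D = max C 1"
  have step: "\<beta> m \<le> D * \<beta> n" if "n \<ge> 1" "n \<le> 2 * m" "m \<le> 2 * n" for m n
  proof -
    have "\<beta> m / \<beta> n \<le> C" by (rule C) (use that in linarith)+
    then have "\<beta> m / \<beta> n \<le> D" by (simp add: D_def)
    then show ?thesis using pos[of n] by (simp add: pos_divide_le_eq)
  qed
  have D: "D \<ge> 1" by (simp add: D_def)
  have "\<beta> m \<le> D ^ k * \<beta> n" if "1 \<le> m" "1 \<le> n" "n \<le> 2 ^ k * m" "m \<le> 2 ^ k * n" for k m n
    using that
  proof (induction k arbitrary: m)
    case 0
    then show ?case by simp
  next
    case (Suc k)
    \<comment> \<open>One doubling or halving of \<open>m\<close> towards \<open>n\<close>, stopped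
      at \<open>n\<close>. Halving rounds up, so that \<open>m \<le> 2 * m'\<close>
      survives.\<close>
    define m' where "m' = (if m \<le> n then min (2 * m) n else max ((m + 1) div 2) n)"
    have m': "1 \<le> m'" "m' \<le> 2 * m" "m \<le> 2 * m'"
      and cases: "n \<le> m' \<or> m' = 2 * m" "m' \<le> n \<or> m' = (m + 1) div 2"
      using Suc.prems(1,2) by (auto simp: m'_def min_def max_def)
    have grow: "j \<le> 2 ^ k * j" for j :: nat by simp
    have "n \<le> 2 ^ k * m'"
      using cases(1) Suc.prems(3) order.trans[OF _ grow[of m']] by (auto simp: mult_ac)
    moreover have "(m + 1) div 2 \<le> 2 ^ k * n"
      using Suc.prems(4) by simp
    then have "m' \<le> 2 ^ k * n"
      using cases(2) order.trans[OF _ grow[of n]] by auto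
    moreover note m'
    ultimately have "\<beta> m \<le> D * \<beta> m'" "\<beta> m' \<le> D ^ k * \<beta> n"
      using step Suc by auto
    then have "\<beta> m \<le> D * (D ^ k * \<beta> n)"
      using D by (meson mult_left_mono order.trans zero_le_one)
    then show ?case by (simp add: mult_ac)
  qed
  with D that show ?thesis by blast
qed

text \<open>About \<open>log 2 n\<close> dyadic steps lead from \<open>n\<close> to 1, so \<beta>
  decays at most polynomially, which geometric decay outweighs.\<close>

lemma slowly_oscillating_summable_geometric:
  assumes pos: "\<And>n. \<beta> n > 0" and osc: "slowly_oscillating \<beta>" and r: "0 < r" "r < 1"
  shows "summable (\<lambda>n. r ^ n / sqrt (\<beta> n))"
proof -
  obtain D where D: "D \<ge> 1"
    "\<And>k m n. 1 \<le> m \<Longrightarrow> 1 \<le> n \<Longrightarrow> n \<le> 2 ^ k * m \<Longrightarrow> m \<le> 2 ^ k * n \<Longrightarrow> \<beta> m \<le> D ^ k * \<beta> n"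
    using slowly_oscillating_comparison[OF pos osc] by blast
  \<comment> \<open>Turns the loss \<open>D ^ Suc k\<close> into a power of
    \<open>2 ^ Suc k\<close>, hence of \<open>2 * n\<close>.\<close>
  obtain A :: nat where A: "D \<le> 2 ^ A"
    using real_arch_pow[of 2 D] by (auto intro: less_imp_le)
  have bound: "1 / sqrt (\<beta> n) \<le> (2 * real n) ^ A / sqrt (\<beta> 1)" if n: "n \<ge> 1" for n
  proof -
    obtain k where k: "2 ^ k \<le> n" "n < 2 ^ Suc k"
      using ex_power_ivl1[of 2 n] n by auto
    have "\<beta> 1 \<le> D ^ Suc k * \<beta> n"
      by (rule D(2)) (use n k in \<open>auto simp: mult_ge1_I intro: less_imp_le\<close>)
    also have "D ^ Suc k \<le> (2 ^ A) ^ Suc k"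
      using A D(1) by (intro power_mono) auto
    also have "(2 ^ A) ^ Suc k = ((2::real) ^ Suc k) ^ A"
      by (metis mult.commute power_mult)
    also have "\<dots> \<le> (2 * real n) ^ A"
      using k(1) by (intro power_mono) (auto simp: numeral_power_le_of_nat_cancel_iff)
    finally have "\<beta> 1 \<le> (2 * real n) ^ A * \<beta> n"
      using pos[of n] by (simp add: mult_right_mono)
    \<comment> \<open>Doubling the exponent is wasteful, but makes the factor a perfect square for
      the square root below.\<close>
    also have "\<dots> \<le> ((2 * real n) ^ A * (2 * real n) ^ A) * \<beta> n"
    proof -
      have "1 \<le> (2 * real n) ^ A" using n by (intro one_le_power) auto
      then show ?thesis using pos[of n] by (intro mult_right_mono) (auto simp: mult_le_cancel_left1)
    qed
    finally have "sqrt (\<beta> 1) \<le> sqrt (((2 * real n) ^ A)\<^sup>2 * \<beta> n)"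
      by (simp add: power2_eq_square)
    also have "\<dots> = (2 * real n) ^ A * sqrt (\<beta> n)"
      by (simp add: real_sqrt_mult)
    finally show ?thesis
      using pos[of 1] pos[of n] by (simp add: field_simps)
  qed
  have "summable (\<lambda>n. 2 ^ A / sqrt (\<beta> 1) * (real n ^ A * r ^ n))"
    by (intro summable_mult summable_power_times_geometric r)
  then show ?thesis
  proof (rule summable_comparison_test_ev[rotated])
    show "\<forall>\<^sub>F n in sequentially. norm (r ^ n / sqrt (\<beta> n)) \<le> 2 ^ A / sqrt (\<beta> 1) * (real n ^ A * r ^ n)"
      using eventually_ge_at_top[of 1]
    proof eventually_elim
      case (elim n)
      have "r ^ n * (1 / sqrt (\<beta> n)) \<le> r ^ n * ((2 * real n) ^ A / sqrt (\<beta> 1))"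
        using bound[OF elim] r by (intro mult_left_mono) auto
      then show ?case
        using r pos[of n] by (simp add: power_mult_distrib mult_ac)
    qed
  qed
qed

section \<open>Powers of the symbol\<close>

text \<open>Cauchy's estimate on a circle of radius \<open>R > 1\<close> handles \<open>m \<ge> Q * n\<close>, and on the circle of
  radius \<open>1/2\<close>, where \<open>\<bar>g\<bar>\<close> stays below some \<open>s < 1\<close>, it handles \<open>n \<ge> Q * m\<close>.\<close>

lemma taylor_coeff_power_decay:
  assumes S: "open S" "cball 0 1 \<subseteq> S" and g: "g holomorphic_on S" "g ` ball 0 1 \<subseteq> ball 0 1"
  obtains r q where "0 < r" "r < 1"
    "\<And>m n. 2 ^ q * n \<le> m \<or> 2 ^ q * m \<le> n \<Longrightarrow> norm (taylor_coeff (\<lambda>z. g z ^ n) m) \<le> r ^ (m + n)"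
proof -
  \<comment> \<open>Compactness gives a uniform margin around the closed disk; radial projection
    then shows that the disk of radius \<open>1 + e\<close> lies in \<open>S\<close>.\<close>
  obtain e where e: "e > 0" "(\<Union>x\<in>cball 0 1. cball x e) \<subseteq> S"
    using compact_subset_open_imp_cball_epsilon_subset[OF compact_cball S] by blast
  define R where "R = 1 + e"
  have R: "R > 1" "cball 0 R \<subseteq> S"
  proof -
    show "R > 1" using e by (simp add: R_def)
    show "cball 0 R \<subseteq> S"
    proof
      fix z :: complex assume z: "z \<in> cball 0 R"
      have "\<exists>x\<in>cball 0 1. z \<in> cball x e"
      proof (cases "norm z \<le> 1")
        case True
        then show ?thesis using e by (intro bexI[of _ z]) auto
      next
        case False
        then have "z \<noteq> 0" by auto
        have "dist (z /\<^sub>R norm z) z = norm z - 1"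
        proof -
          have "z /\<^sub>R norm z - z = (1 / norm z - 1) *\<^sub>R z"
            by (simp add: algebra_simps divide_inverse)
          then have "dist (z /\<^sub>R norm z) z = \<bar>1 / norm z - 1\<bar> * norm z"
            by (simp add: dist_norm)
          also have "\<dots> = norm z - 1" using False \<open>z \<noteq> 0\<close> by (simp add: abs_if field_simps)
          finally show ?thesis .
        qed
        then show ?thesis
          using z False \<open>z \<noteq> 0\<close> by (intro bexI[of _ "z /\<^sub>R norm z"]) (auto simp: R_def)
      qed
      then show "z \<in> S" using e(2) by blast
    qed
  qed
  have gR: "g holomorphic_on cball 0 R" using g(1) R(2) by (rule holomorphic_on_subset)
  have "compact (g ` cball 0 R)"
    by (intro compact_continuous_image holomorphic_on_imp_continuous_on gR compact_cball)
  then obtain B where B: "\<And>z. z \<in> cball 0 R \<Longrightarrow> norm (g z) \<le> B" "B > 0"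
    using compact_imp_bounded[of "g ` cball 0 R"] unfolding bounded_pos by blast
  have g2: "g holomorphic_on cball 0 (1/2)"
    using R by (intro holomorphic_on_subset[OF gR]) auto
  have "continuous_on (cball 0 (1/2)) (\<lambda>z. norm (g z))"
    by (intro continuous_intros holomorphic_on_imp_continuous_on g2)
  then obtain x where x: "x \<in> cball 0 (1/2)" "\<And>z. z \<in> cball 0 (1/2) \<Longrightarrow> norm (g z) \<le> norm (g x)"
    using continuous_attains_sup[of "cball 0 (1/2) :: complex set" "\<lambda>z. norm (g z)"] by auto
  have gx: "norm (g x) < 1"
  proof -
    have "g x \<in> g ` ball 0 1" using x(1) by (intro imageI) auto
    with g(2) show ?thesis by auto
  qed
  define u where "u = max (1 / R) (norm (g x))"
  have u: "0 < u" "u < 1" using R gx by (auto simp: u_def less_max_iff_disj)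
  \<comment> \<open>The cube root splits the decay into three equal factors: one absorbs the growth
    \<open>B ^ n\<close> or \<open>2 ^ m\<close>, the other two leave
    \<open>r ^ (m + n)\<close>.\<close>
  define r where "r = root 3 u"
  have r: "0 < r" "r < 1" "r ^ 3 = u"
    using u unfolding r_def by (auto simp: real_root_pow_pos2)
  have "(\<lambda>n. r ^ n) \<longlonglongrightarrow> 0" using r by (intro LIMSEQ_realpow_zero) auto
  then have "eventually (\<lambda>n. r ^ n < 1 / max B 2) sequentially"
    by (rule order_tendstoD) (simp add: less_max_iff_disj)
  then obtain Q0 where Q0: "\<And>n. n \<ge> Q0 \<Longrightarrow> r ^ n < 1 / max B 2"
    unfolding eventually_sequentially by blast
  \<comment> \<open>A power of two, to match the dyadic blocks; it is at least \<open>Q0\<close>.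
    The maximum with 2 serves the circle of radius 1/2, whose Cauchy estimate costs
    \<open>2 ^ m\<close>.\<close>
  define Q :: nat where "Q = 2 ^ Q0"
  have Q: "Q \<ge> 1" "max B 2 * r ^ Q \<le> 1"
  proof -
    show "Q \<ge> 1" by (simp add: Q_def)
    have "r ^ Q < 1 / max B 2" by (rule Q0) (simp add: Q_def less_imp_le)
    then show "max B 2 * r ^ Q \<le> 1" by (simp add: field_simps)
  qed
  have *: "b ^ i * r ^ j \<le> 1" if "0 < b" "b \<le> max B 2" "Q * i \<le> j" for b i j
  proof -
    have "b ^ i * r ^ j \<le> max B 2 ^ i * r ^ (Q * i)"
      using that r by (intro mult_mono power_mono power_decreasing) auto
    also have "\<dots> = (max B 2 * r ^ Q) ^ i" by (simp add: power_mult power_mult_distrib)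
    also have "\<dots> \<le> 1" using Q(2) r by (intro power_le_one) auto
    finally show ?thesis .
  qed
  have up: "norm (taylor_coeff (\<lambda>z. g z ^ n) m) \<le> r ^ (m + n)" if mn: "Q * n \<le> m" for m n
  proof -
    have "norm (taylor_coeff (\<lambda>z. g z ^ n) m) \<le> B ^ n / R ^ m"
      using R B by (intro norm_taylor_coeff_le holomorphic_intros gR) (auto simp: norm_power power_mono)
    also have "\<dots> = B ^ n * (1 / R) ^ m" by (simp add: power_one_over)
    also have "\<dots> \<le> B ^ n * (r ^ 3) ^ m"
      using R B unfolding r by (intro mult_left_mono power_mono) (auto simp: u_def)
    also have "\<dots> = (B ^ n * r ^ m) * r ^ (m + m)" by (simp add: power_add power3_eq_cube power_mult_distrib)
    also have "\<dots> \<le> 1 * r ^ (m + m)"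
      using * [of B n m] mn B r by (intro mult_right_mono) auto
    also have "\<dots> \<le> r ^ (m + n)"
    proof -
      have "n \<le> m" using mn Q(1) by (metis le_trans mult_le_mono1 nat_mult_1)
      then show ?thesis using r by (simp add: power_decreasing)
    qed
    finally show ?thesis .
  qed
  have down: "norm (taylor_coeff (\<lambda>z. g z ^ n) m) \<le> r ^ (m + n)" if mn: "Q * m \<le> n" for m n
  proof -
    have "norm (taylor_coeff (\<lambda>z. g z ^ n) m) \<le> u ^ n / (1 / 2) ^ m"
    proof (intro norm_taylor_coeff_le holomorphic_intros g2)
      show "norm (g z ^ n) \<le> u ^ n" if "norm z = 1 / 2" for z
        unfolding norm_power using x(2)[of z] that by (intro power_mono) (auto simp: u_def)
    qed auto
    also have "\<dots> = 2 ^ m * (r ^ 3) ^ n" by (simp add: r power_one_over)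
    also have "\<dots> = (2 ^ m * r ^ n) * r ^ (n + n)" by (simp add: power_add power3_eq_cube power_mult_distrib)
    also have "\<dots> \<le> 1 * r ^ (n + n)"
      using * [of 2 m n] mn r by (intro mult_right_mono) auto
    also have "\<dots> \<le> r ^ (m + n)"
    proof -
      have "m \<le> n" using mn Q(1) by (metis le_trans mult_le_mono1 nat_mult_1)
      then show ?thesis using r by (simp add: power_decreasing)
    qed
    finally show ?thesis .
  qed
  show ?thesis
    by (rule that[of r Q0]) (use r up down in \<open>auto simp: Q_def\<close>)
qed

text \<open>On the disk of radius 1/2 the values of \<open>g\<close> stay in a disk of radius
  \<open>s < 1\<close>, where the series of \<open>f\<close> converges absolutely. The partial sums
  thus converge uniformly, and Cauchy's estimate passes this to each coefficient.\<close>

lemma taylor_coeff_compose_sums: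
  assumes f: "f holomorphic_on ball 0 1" and g: "g holomorphic_on ball 0 1" "g ` ball 0 1 \<subseteq> ball 0 1"
  shows "(\<lambda>n. taylor_coeff f n * taylor_coeff (\<lambda>z. g z ^ n) m) sums taylor_coeff (f \<circ> g) m"
proof -
  define F where "F N z = (\<Sum>n<N. taylor_coeff f n * g z ^ n)" for N z
  have fg: "(f \<circ> g) holomorphic_on ball 0 1"
    using g by (intro holomorphic_on_compose_gen[OF g(1) f]) auto
  have hF: "F N holomorphic_on ball 0 1" for N
    unfolding F_def by (intro holomorphic_intros g)
  have "continuous_on (cball 0 (1/2)) (\<lambda>z. norm (g z))"
    by (intro continuous_intros holomorphic_on_imp_continuous_on holomorphic_on_subset[OF g(1)]) auto
  then obtain x where x: "x \<in> cball 0 (1/2)" "\<And>z. z \<in> cball 0 (1/2) \<Longrightarrow> norm (g z) \<le> norm (g x)"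
    using continuous_attains_sup[of "cball 0 (1/2) :: complex set" "\<lambda>z. norm (g z)"] by auto
  define s where "s = norm (g x)"
  have "g x \<in> g ` ball 0 1" using x(1) by (intro imageI) auto
  with g(2) have s: "0 \<le> s" "s < 1" by (auto simp: s_def)
  have series: "(\<lambda>n. taylor_coeff f n * w ^ n) sums f w" if "norm w < 1" for w
    using holomorphic_power_series[OF f, of w] that by (simp add: taylor_coeff_def)
  have "summable (\<lambda>n. norm (taylor_coeff f n * of_real s ^ n))"
  proof (rule powser_insidea)
    show "summable (\<lambda>n. taylor_coeff f n * of_real ((1 + s) / 2) ^ n)"
      using s by (intro sums_summable[OF series]) (simp only: norm_of_real, simp)
    show "norm (complex_of_real s) < norm (complex_of_real ((1 + s) / 2))"
      using s by (simp only: norm_of_real, simp)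
  qed
  then have sm: "summable (\<lambda>n. norm (taylor_coeff f n) * s ^ n)"
    using s by (simp add: norm_mult norm_power)
  have "uniform_limit (cball 0 (1/2)) F (\<lambda>z. \<Sum>n. taylor_coeff f n * g z ^ n) sequentially"
    unfolding F_def
    by (rule Weierstrass_m_test[OF _ sm])
      (auto simp: norm_mult norm_power s_def intro!: mult_left_mono power_mono x)
  then have unif: "\<forall>\<^sub>F N in sequentially. \<forall>z\<in>cball 0 (1/2). dist (F N z) (\<Sum>n. taylor_coeff f n * g z ^ n) < e"
    if "e > 0" for e
    using that by (rule uniform_limitD)
  have "(\<lambda>N. taylor_coeff (F N) m) \<longlonglongrightarrow> taylor_coeff (f \<circ> g) m"
  proof (rule tendstoI)
    fix e :: real assume e: "e > 0"
    \<comment> \<open>The factor \<open>2 ^ m\<close> compensates the loss in Cauchy's estimate at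
      radius 1/2.\<close>
    have "\<forall>\<^sub>F N in sequentially. \<forall>z\<in>cball 0 (1/2). dist (F N z) (\<Sum>n. taylor_coeff f n * g z ^ n) < e / 2 / 2 ^ m"
      using e by (intro unif) simp
    then show "\<forall>\<^sub>F N in sequentially. dist (taylor_coeff (F N) m) (taylor_coeff (f \<circ> g) m) < e"
    proof eventually_elim
      case (elim N)
      have "norm (taylor_coeff (\<lambda>z. F N z - (f \<circ> g) z) m) \<le> (e / 2 / 2 ^ m) / (1/2) ^ m"
      proof (rule norm_taylor_coeff_le)
        show "(\<lambda>z. F N z - (f \<circ> g) z) holomorphic_on cball 0 (1/2)"
          by (rule holomorphic_on_subset[OF holomorphic_on_diff[OF hF fg]]) auto
        show "norm (F N z - (f \<circ> g) z) \<le> e / 2 / 2 ^ m" if z: "norm z = 1/2" for z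
        proof -
          have "norm (g z) \<le> s" using x(2)[of z] z by (simp add: s_def)
          then have "(\<Sum>n. taylor_coeff f n * g z ^ n) = f (g z)"
            using s by (intro sums_unique[symmetric] series) auto
          with elim[rule_format, of z] z show ?thesis by (simp add: dist_norm)
        qed
      qed auto
      also have "\<dots> = e / 2" by (simp add: power_one_over)
      finally show ?case
        using e taylor_coeff_diff[OF hF[of N] fg] by (simp add: dist_norm)
    qed
  qed
  moreover have "taylor_coeff (F N) m = (\<Sum>n<N. taylor_coeff f n * taylor_coeff (\<lambda>z. g z ^ n) m)" for N
    unfolding F_def by (intro taylor_coeff_sum) (auto intro!: holomorphic_intros g)
  ultimately show ?thesis by (simp add: sums_def)
qed

section \<open>Dyadic blocks\<close>

text \<open>Multiplying out instead of dividing also forces \<open>n\<close> to be positive, as the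
  comparison of weights requires.\<close>

definition near_block :: "nat \<Rightarrow> nat \<Rightarrow> nat set" where
  "near_block p i = {n. 2 ^ i \<le> 2 ^ p * n \<and> n \<le> 2 ^ p * 2 ^ i}"

lemma finite_near_block [simp]: "finite (near_block p i)"
  by (rule finite_subset[of _ "{..2 ^ p * 2 ^ i}"]) (auto simp: near_block_def)

text \<open>If \<open>n\<close> lies in the blocks of \<open>k\<close> and \<open>i\<close>, then
  \<open>2 ^ i \<le> 2 ^ p * n \<le> 2 ^ (2 * p) * 2 ^ k\<close>, so all indices lie within
  \<open>2 * p\<close> of the smallest one.\<close>

lemma card_near_block_le: "card {i. i < I \<and> n \<in> near_block p i} \<le> 2 * p + 1"
proof (cases "{i. i < I \<and> n \<in> near_block p i} = {}")
  case False
  let ?A = "{i. i < I \<and> n \<in> near_block p i}"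
  define k where "k = Min ?A"
  have k: "n \<in> near_block p k" "\<And>i. i \<in> ?A \<Longrightarrow> k \<le> i"
    using Min_in[of ?A] False by (auto simp: k_def)
  have "?A \<subseteq> {k..k + 2 * p}"
  proof
    fix i assume i: "i \<in> ?A"
    then have "(2::nat) ^ i \<le> 2 ^ p * n" by (simp add: near_block_def)
    also have "\<dots> \<le> 2 ^ p * (2 ^ p * 2 ^ k)"
      using k(1) by (simp add: near_block_def)
    also have "\<dots> = 2 ^ (k + 2 * p)" by (simp add: power_add mult_2)
    finally have "i \<le> k + 2 * p" by simp
    with k(2)[OF i] show "i \<in> {k..k + 2 * p}" by simp
  qed
  then have "card ?A \<le> card {k..k + 2 * p}" by (intro card_mono) auto
  then show ?thesis by simp
next
  case True
  then show ?thesis by (simp only: card.empty zero_le)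
qed

lemma sum_near_blocks_le:
  fixes w :: "nat \<Rightarrow> real"
  assumes w: "\<And>n. w n \<ge> 0" "summable w"
  shows "(\<Sum>i<I. \<Sum>n\<in>near_block p i. w n) \<le> real (2 * p + 1) * suminf w"
proof -
  define N where "N = (\<Union>i<I. near_block p i)"
  have fin: "finite N" by (simp add: N_def)
  have "(\<Sum>i<I. \<Sum>n\<in>near_block p i. w n) = (\<Sum>i<I. \<Sum>n\<in>N. if n \<in> near_block p i then w n else 0)"
  proof (rule sum.cong[OF refl])
    fix i assume "i \<in> {..<I}"
    then have "N \<inter> near_block p i = near_block p i" by (auto simp: N_def)
    then show "(\<Sum>n\<in>near_block p i. w n) = (\<Sum>n\<in>N. if n \<in> near_block p i then w n else 0)"
      by (simp add: sum.inter_restrict[OF fin, symmetric])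
  qed
  also have "\<dots> = (\<Sum>n\<in>N. \<Sum>i<I. if n \<in> near_block p i then w n else 0)"
    by (rule sum.swap)
  also have "\<dots> = (\<Sum>n\<in>N. card {i. i < I \<and> n \<in> near_block p i} * w n)"
  proof (rule sum.cong[OF refl])
    fix n
    have "{..<I} \<inter> {i. n \<in> near_block p i} = {i. i < I \<and> n \<in> near_block p i}" by auto
    then show "(\<Sum>i<I. if n \<in> near_block p i then w n else 0) = card {i. i < I \<and> n \<in> near_block p i} * w n"
      by (simp add: sum.If_cases)
  qed
  also have "\<dots> \<le> (\<Sum>n\<in>N. (2 * p + 1) * w n)"
    by (intro sum_mono mult_right_mono w of_nat_mono card_near_block_le)
  also have "\<dots> = real (2 * p + 1) * (\<Sum>n\<in>N. w n)"
    by (simp add: sum_distrib_left)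
  also have "\<dots> \<le> real (2 * p + 1) * suminf w"
    by (intro mult_left_mono sum_le_suminf w fin) auto
  finally show ?thesis .
qed

lemma sum_dyadic_blocks:
  fixes h :: "nat \<Rightarrow> 'a :: comm_monoid_add"
  shows "(\<Sum>m<2 ^ I. h m) = h 0 + (\<Sum>i<I. \<Sum>m\<in>{2 ^ i..<2 ^ Suc i}. h m)"
proof (induction I)
  case (Suc I)
  have "(\<Sum>m<2 ^ Suc I. h m) = (\<Sum>m<2 ^ I. h m) + (\<Sum>m\<in>{2 ^ I..<2 ^ Suc I}. h m)"
    unfolding lessThan_atLeast0 by (rule sum.atLeastLessThan_concat[symmetric]) auto
  then show ?case by (simp only: Suc sum.lessThan_Suc add.assoc)
qed simp

section \<open>Boundedness for a map analytic near the closed disk\<close>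

lemma bounded_composition_analytic_on_cball:
  assumes pos: "\<And>n. \<beta> n > 0" and M: "\<And>n. \<beta> n \<le> M" and osc: "slowly_oscillating \<beta>"
    and S: "open S" "cball 0 1 \<subseteq> S" and g: "g holomorphic_on S" "g ` ball 0 1 \<subseteq> ball 0 1"
  shows "bounded_composition \<beta> g"
proof -
  have gb: "g holomorphic_on ball 0 1" and gc: "g holomorphic_on cball 0 1"
    using S(2) ball_subset_cball[of 0 1] by (blast intro: holomorphic_on_subset[OF g(1)])+
  have "g 0 \<in> ball 0 1" by (rule subsetD[OF g(2)]) simp
  then have g0: "norm (g 0) < 1" by simp
  have gcb: "g ` cball 0 1 \<subseteq> cball 0 1"
  proof -
    have "continuous_on (closure (ball 0 1)) g"
      using holomorphic_on_imp_continuous_on[OF gc] by simp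
    then have "g ` closure (ball 0 1) \<subseteq> closure (ball 0 1)"
      by (rule image_closure_subset) (use g(2) closure_subset[of "ball 0 1 :: complex set"] in auto)
    then show ?thesis by simp
  qed
  define a where "a m n = taylor_coeff (\<lambda>z. g z ^ n) m" for m n
  obtain r q where r: "0 < r" "r < 1"
    and decay: "\<And>m n. 2 ^ q * n \<le> m \<or> 2 ^ q * m \<le> n \<Longrightarrow> norm (a m n) \<le> r ^ (m + n)"
    using taylor_coeff_power_decay[OF S g] unfolding a_def by metis
  obtain D where D: "D \<ge> 1"
    "\<And>k m n. 1 \<le> m \<Longrightarrow> 1 \<le> n \<Longrightarrow> n \<le> 2 ^ k * m \<Longrightarrow> m \<le> 2 ^ k * n \<Longrightarrow> \<beta> m \<le> D ^ k * \<beta> n"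
    using slowly_oscillating_comparison[OF pos osc] by blast
  \<comment> \<open>One more than \<open>q\<close>, because \<open>m\<close> in block
    \<open>i\<close> may be almost \<open>2 ^ Suc i\<close>.\<close>
  define p where "p = Suc q"
  define K where "K = (1 + norm (g 0)) / (1 - norm (g 0))"
  have K: "K \<ge> 0" using g0 by (simp add: K_def)
  define T where "T = (\<Sum>n. r ^ n / sqrt (\<beta> n))"
  have sT: "summable (\<lambda>n. r ^ n / sqrt (\<beta> n))"
    by (rule slowly_oscillating_summable_geometric[OF pos osc r])
  \<comment> \<open>Both factors 2 come from squaring a sum. In the near part,
    \<open>D ^ Suc p\<close> compares weights, \<open>K\<close> is Littlewood's constant and
    \<open>2 * p + 1\<close> bounds the overlap; the far part sums a geometric series in
    \<open>r\<^sup>2\<close>.\<close>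
  define C where "C = 2 * (D ^ Suc p * K * real (2 * p + 1)) + 2 * (T\<^sup>2 * M / (1 - r\<^sup>2))"
  \<comment> \<open>The constant does not depend on \<open>I\<close>, so summability and the norm
    bound both follow.\<close>
  have main: "(\<Sum>m<2 ^ I. (norm (taylor_coeff (f \<circ> g) m))\<^sup>2 * \<beta> m)
      \<le> C * (\<Sum>n. (norm (taylor_coeff f n))\<^sup>2 * \<beta> n)" if f: "f \<in> H2 \<beta>" for f I
  proof -
    define c where "c = taylor_coeff f"
    define w where "w n = (norm (c n))\<^sup>2 * \<beta> n" for n
    have w: "\<And>n. w n \<ge> 0" "summable w"
      using f pos by (auto simp: w_def[abs_def] c_def H2_def less_imp_le)
    define W where "W = suminf w"
    have W: "W \<ge> 0" unfolding W_def by (intro suminf_nonneg w)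
    have c_le: "norm (c n) \<le> sqrt W / sqrt (\<beta> n)" for n
    proof -
      have "w n \<le> W"
        using sum_le_suminf[OF w(2), of "{n}"] w(1) by (simp add: W_def)
      then have "(norm (c n))\<^sup>2 \<le> W / \<beta> n"
        using pos[of n] by (simp add: w_def pos_le_divide_eq)
      then have "sqrt ((norm (c n))\<^sup>2) \<le> sqrt (W / \<beta> n)" by (rule real_sqrt_le_mono)
      then show ?thesis by (simp add: real_sqrt_divide)
    qed
    have sums: "(\<lambda>n. c n * a m n) sums taylor_coeff (f \<circ> g) m" for m
      unfolding c_def a_def
      by (rule taylor_coeff_compose_sums) (use f gb g in \<open>auto simp: H2_def\<close>)
    \<comment> \<open>The set \<open>A\<close> stays general: it will be a near block, and the empty
      set for \<open>m = 0\<close>, which lies in no dyadic block.\<close>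
    have far: "norm (taylor_coeff (f \<circ> g) m - (\<Sum>n\<in>A. c n * a m n)) \<le> sqrt W * T * r ^ m"
      if A: "finite A" "\<And>n. n \<notin> A \<Longrightarrow> 2 ^ q * n \<le> m \<or> 2 ^ q * m \<le> n" for A m
    proof -
      have "(\<lambda>n. if n \<in> A then c n * a m n else 0) sums (\<Sum>n\<in>A. c n * a m n)"
        by (rule sums_If_finite_set[OF A(1)])
      from sums_diff[OF sums[of m] this]
      have s: "(\<lambda>n. if n \<in> A then 0 else c n * a m n) sums
          (taylor_coeff (f \<circ> g) m - (\<Sum>n\<in>A. c n * a m n))"
        by (rule sums_cong[THEN iffD1, rotated]) auto
      have le: "norm (if n \<in> A then 0 else c n * a m n) \<le> sqrt W * r ^ m * (r ^ n / sqrt (\<beta> n))" for n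
      proof (cases "n \<in> A")
        case False
        have "norm (c n * a m n) \<le> (sqrt W / sqrt (\<beta> n)) * r ^ (m + n)"
          unfolding norm_mult
          by (intro mult_mono c_le decay A(2)[OF False]) (use W pos[of n] in auto)
        with False show ?thesis by (simp add: power_add mult_ac)
      qed (use W r pos[of n] in auto)
      have sb: "summable (\<lambda>n. sqrt W * r ^ m * (r ^ n / sqrt (\<beta> n)))"
        by (intro summable_mult sT)
      have "norm (\<Sum>n. if n \<in> A then 0 else c n * a m n) \<le> (\<Sum>n. sqrt W * r ^ m * (r ^ n / sqrt (\<beta> n)))"
        by (rule norm_suminf_le[OF le sb])
      also have "\<dots> = sqrt W * r ^ m * T"
        unfolding T_def by (rule suminf_mult[OF sT])
      finally show ?thesis using sums_unique[OF s] by (simp add: mult_ac)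
    qed
    define near where "near m i = (\<Sum>n\<in>near_block p i. c n * a m n)" for m i
    have near_le: "(\<Sum>m\<in>{2 ^ i..<2 ^ Suc i}. (norm (near m i))\<^sup>2 * \<beta> m)
        \<le> D ^ Suc p * K * (\<Sum>n\<in>near_block p i. w n)" for i
    proof -
      define N :: nat where "N = Suc (2 ^ p * 2 ^ i)"
      \<comment> \<open>Padding with zeros makes the near part a polynomial in \<open>g\<close>, as
        Littlewood's bound requires.\<close>
      define b where "b n = (if n \<in> near_block p i then c n else 0)" for n
      have NN: "{..<N} \<inter> near_block p i = near_block p i"
        by (auto simp: N_def near_block_def)
      have near_eq: "near m i = taylor_coeff (\<lambda>z. \<Sum>n<N. b n * g z ^ n) m" for m
      proof -
        have "near m i = (\<Sum>n<N. if n \<in> near_block p i then c n * a m n else 0)"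
          unfolding near_def by (simp add: sum.inter_restrict[symmetric] NN)
        also have "\<dots> = (\<Sum>n<N. b n * a m n)"
          by (intro sum.cong) (auto simp: b_def)
        also have "\<dots> = taylor_coeff (\<lambda>z. \<Sum>n<N. b n * g z ^ n) m"
          unfolding a_def by (intro taylor_coeff_sum[symmetric]) (auto intro!: holomorphic_intros gb)
        finally show ?thesis .
      qed
      \<comment> \<open>The weight is frozen at \<open>2 ^ i\<close> to apply the unweighted bound,
        then exchanged for \<open>\<beta> n\<close> at cost \<open>D ^ p\<close>.\<close>
      have "(\<Sum>m\<in>{2 ^ i..<2 ^ Suc i}. (norm (near m i))\<^sup>2 * \<beta> m)
          \<le> (\<Sum>m\<in>{2 ^ i..<2 ^ Suc i}. (norm (near m i))\<^sup>2 * (D * \<beta> (2 ^ i)))"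
      proof (intro sum_mono mult_left_mono)
        show "\<beta> m \<le> D * \<beta> (2 ^ i)" if "m \<in> {2 ^ i..<2 ^ Suc i}" for m
          using D(2)[of m "2 ^ i" 1] that order.trans[of 1 "2 ^ i" m] by auto
      qed auto
      also have "\<dots> \<le> (\<Sum>m<2 ^ Suc i. (norm (near m i))\<^sup>2 * (D * \<beta> (2 ^ i)))"
        using D(1) pos[of "2 ^ i"] by (intro sum_mono2) auto
      also have "\<dots> = D * \<beta> (2 ^ i) * (\<Sum>m<2 ^ Suc i. (norm (near m i))\<^sup>2)"
        by (simp only: sum_distrib_left mult_ac)
      also have "\<dots> \<le> D * \<beta> (2 ^ i) * (K * (\<Sum>n<N. (norm (b n))\<^sup>2))"
        unfolding near_eq K_def
        using D(1) pos[of "2 ^ i"] by (intro mult_left_mono Littlewood_subordination gc gcb g0) auto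
      also have "(\<Sum>n<N. (norm (b n))\<^sup>2) = (\<Sum>n<N. if n \<in> near_block p i then (norm (c n))\<^sup>2 else 0)"
        by (intro sum.cong) (auto simp: b_def)
      also have "\<dots> = (\<Sum>n\<in>near_block p i. (norm (c n))\<^sup>2)"
        by (simp add: sum.inter_restrict[symmetric] NN)
      also have "D * \<beta> (2 ^ i) * (K * (\<Sum>n\<in>near_block p i. (norm (c n))\<^sup>2))
          = D * K * (\<Sum>n\<in>near_block p i. (norm (c n))\<^sup>2 * \<beta> (2 ^ i))"
        by (simp add: sum_distrib_left mult_ac)
      also have "\<dots> \<le> D * K * (\<Sum>n\<in>near_block p i. (norm (c n))\<^sup>2 * (D ^ p * \<beta> n))"
      proof (intro mult_left_mono sum_mono)
        show "\<beta> (2 ^ i) \<le> D ^ p * \<beta> n" if n: "n \<in> near_block p i" for n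
        proof (rule D(2))
          show "1 \<le> n" using n by (cases n) (auto simp: near_block_def)
        qed (use n in \<open>auto simp: near_block_def\<close>)
      qed (use D K in auto)
      also have "\<dots> = D ^ Suc p * K * (\<Sum>n\<in>near_block p i. w n)"
        by (simp add: w_def sum_distrib_left mult_ac)
      finally show ?thesis .
    qed
    have far_near: "norm (taylor_coeff (f \<circ> g) m - near m i) \<le> sqrt W * T * r ^ m"
      if m: "m \<in> {2 ^ i..<2 ^ Suc i}" for m i
      unfolding near_def
    proof (rule far)
      fix n assume "n \<notin> near_block p i"
      then consider "2 ^ p * n < 2 ^ i" | "2 ^ p * 2 ^ i < n" by (auto simp: near_block_def)
      then show "2 ^ q * n \<le> m \<or> 2 ^ q * m \<le> n"
      proof cases
        case 1
        then show ?thesis using m by (auto simp: p_def)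
      next
        case 2
        have "2 ^ q * m \<le> 2 ^ q * 2 ^ Suc i" using m by (intro mult_left_mono) auto
        also have "\<dots> = 2 ^ p * 2 ^ i" by (simp add: p_def)
        also note 2
        finally show ?thesis by simp
      qed
    qed simp
    have sq: "(norm x)\<^sup>2 \<le> 2 * (norm y)\<^sup>2 + 2 * (W * T\<^sup>2 * (r\<^sup>2) ^ m)"
      if "norm (x - y) \<le> sqrt W * T * r ^ m" for x y :: complex and m
    proof -
      have "norm x \<le> norm y + norm (x - y)" by (metis add.commute diff_add_cancel norm_triangle_ineq)
      then have "(norm x)\<^sup>2 \<le> (norm y + norm (x - y))\<^sup>2" by (intro power_mono) auto
      also have "\<dots> \<le> 2 * (norm y)\<^sup>2 + 2 * (norm (x - y))\<^sup>2"
        using sum_squares_bound[of "norm y" "norm (x - y)"] by (simp add: power2_sum)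
      also have "(norm (x - y))\<^sup>2 \<le> (sqrt W * T * r ^ m)\<^sup>2" using that by (intro power_mono) auto
      also have "\<dots> = W * T\<^sup>2 * (r\<^sup>2) ^ m"
        using W by (simp add: power_mult_distrib mult.commute flip: power_mult)
      finally show ?thesis by simp
    qed
    define R where "R m = 2 * (W * T\<^sup>2 * (r\<^sup>2) ^ m)" for m
    have R: "R m \<ge> 0" for m using W by (simp add: R_def)
    have "(\<Sum>m<2 ^ I. (norm (taylor_coeff (f \<circ> g) m))\<^sup>2 * \<beta> m)
        = (norm (taylor_coeff (f \<circ> g) 0))\<^sup>2 * \<beta> 0
          + (\<Sum>i<I. \<Sum>m\<in>{2 ^ i..<2 ^ Suc i}. (norm (taylor_coeff (f \<circ> g) m))\<^sup>2 * \<beta> m)"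
      by (rule sum_dyadic_blocks)
    also have "\<dots> \<le> R 0 * \<beta> 0
          + (\<Sum>i<I. \<Sum>m\<in>{2 ^ i..<2 ^ Suc i}. (2 * (norm (near m i))\<^sup>2 + R m) * \<beta> m)"
    proof (intro add_mono sum_mono mult_right_mono)
      show "(norm (taylor_coeff (f \<circ> g) 0))\<^sup>2 \<le> R 0"
        using sq[of _ 0 0] far[of "{}" 0] by (simp add: R_def)
      show "(norm (taylor_coeff (f \<circ> g) m))\<^sup>2 \<le> 2 * (norm (near m i))\<^sup>2 + R m"
        if "m \<in> {2 ^ i..<2 ^ Suc i}" for m i
        unfolding R_def by (intro sq far_near that)
    qed (use pos in \<open>auto intro: less_imp_le\<close>)
    also have "\<dots> = 2 * (\<Sum>i<I. \<Sum>m\<in>{2 ^ i..<2 ^ Suc i}. (norm (near m i))\<^sup>2 * \<beta> m) + (\<Sum>m<2 ^ I. R m * \<beta> m)"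
      by (simp only: sum_dyadic_blocks sum.distrib sum_distrib_left distrib_right mult.assoc add_ac)
    also have "(\<Sum>i<I. \<Sum>m\<in>{2 ^ i..<2 ^ Suc i}. (norm (near m i))\<^sup>2 * \<beta> m)
        \<le> D ^ Suc p * K * (\<Sum>i<I. \<Sum>n\<in>near_block p i. w n)"
      unfolding sum_distrib_left[of _ _ "{..<I}"] by (intro sum_mono near_le)
    also have "\<dots> \<le> D ^ Suc p * K * (real (2 * p + 1) * W)"
      unfolding W_def using D(1) K by (intro mult_left_mono sum_near_blocks_le w) auto
    \<comment> \<open>The far errors need only the upper bound \<open>M\<close> on the
      weight.\<close>
    also have "(\<Sum>m<2 ^ I. R m * \<beta> m) \<le> (\<Sum>m<2 ^ I. 2 * W * T\<^sup>2 * M * (r\<^sup>2) ^ m)"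
    proof (rule sum_mono)
      show "R m * \<beta> m \<le> 2 * W * T\<^sup>2 * M * (r\<^sup>2) ^ m" for m
        using mult_left_mono[OF M[of m] R[of m]] by (simp add: R_def mult_ac)
    qed
    also have "\<dots> = 2 * W * T\<^sup>2 * M * (\<Sum>m<2 ^ I. (r\<^sup>2) ^ m)" by (simp add: sum_distrib_left)
    also have "\<dots> \<le> 2 * W * T\<^sup>2 * M * (1 / (1 - r\<^sup>2))"
    proof (intro mult_left_mono)
      have "r\<^sup>2 < 1" using r by (simp add: power_less_one_iff)
      then show "(\<Sum>m<2 ^ I. (r\<^sup>2) ^ m) \<le> 1 / (1 - r\<^sup>2)"
        using sum_le_suminf[of "\<lambda>m. (r\<^sup>2) ^ m" "{..<2 ^ I}"] by (auto simp: suminf_geometric summable_geometric)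
      show "0 \<le> 2 * W * T\<^sup>2 * M"
        using W pos[of 0] M[of 0] by auto
    qed
    also have "2 * (D ^ Suc p * K * (real (2 * p + 1) * W)) + 2 * W * T\<^sup>2 * M * (1 / (1 - r\<^sup>2)) = C * W"
      by (simp add: C_def algebra_simps)
    finally show ?thesis
      by (simp add: W_def w_def[abs_def] c_def del: o_apply)
  qed
  have H2: "f \<circ> g \<in> H2 \<beta> \<and> H2_norm \<beta> (f \<circ> g) \<le> sqrt C * H2_norm \<beta> f" if f: "f \<in> H2 \<beta>" for f
  proof -
    define h where "h m = (norm (taylor_coeff (f \<circ> g) m))\<^sup>2 * \<beta> m" for m
    define W where "W = (\<Sum>n. (norm (taylor_coeff f n))\<^sup>2 * \<beta> n)"
    have h: "h m \<ge> 0" for m using pos[of m] by (simp add: h_def)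
    have le: "(\<Sum>m<n. h m) \<le> C * W" for n
    proof -
      \<comment> \<open>Every partial sum sits inside a dyadic one, since
        \<open>n < 2 ^ n\<close>.\<close>
      have "(\<Sum>m<n. h m) \<le> (\<Sum>m<2 ^ n. h m)"
        by (intro sum_mono2) (auto simp: h intro: order.strict_trans less_exp)
      also have "\<dots> \<le> C * W" unfolding h_def W_def by (rule main[OF f])
      finally show ?thesis .
    qed
    have sh: "summable h" by (rule summableI_nonneg_bounded[OF h le])
    moreover have "(f \<circ> g) holomorphic_on ball 0 1"
      using f g(2) by (intro holomorphic_on_compose_gen[OF gb]) (auto simp: H2_def)
    moreover have "suminf h \<le> C * W" by (rule suminf_le_const[OF sh le])
    ultimately show ?thesis
      by (simp add: H2_def H2_norm_def h_def[abs_def] W_def flip: real_sqrt_mult)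
  qed
  then show ?thesis unfolding bounded_composition_def by blast
qed

theorem mainTheorem19:
  fixes \<beta> :: "nat \<Rightarrow> real" and \<phi> :: "complex \<Rightarrow> complex"
  assumes pos: "\<And>n. \<beta> n > 0"
    and bdd: "\<exists>M. \<forall>n. \<beta> n \<le> M"
    and osc: "slowly_oscillating \<beta>"
    and sym: "symbol \<phi>"
    and ext: "\<exists>S g. open S \<and> cball 0 1 \<subseteq> S \<and> g holomorphic_on S \<and>
                 (\<forall>z\<in>ball 0 1. g z = \<phi> z)"
  shows "bounded_composition \<beta> \<phi>"
proof -
  obtain M where M: "\<And>n. \<beta> n \<le> M" using bdd by blast
  obtain S g where S: "open S" "cball 0 1 \<subseteq> S" and g: "g holomorphic_on S"
    and eq: "\<And>z. z \<in> ball 0 1 \<Longrightarrow> g z = \<phi> z"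
    using ext by blast
  have "g ` ball 0 1 \<subseteq> ball 0 1"
    using sym by (auto simp: symbol_def eq)
  then have bc: "bounded_composition \<beta> g"
    by (rule bounded_composition_analytic_on_cball[OF pos M osc S g])
  \<comment> \<open>Both compositions agree on the disk, so membership in \<open>H2\<close> and the
    norm transfer from \<open>g\<close> to the symbol.\<close>
  have "taylor_coeff (f \<circ> \<phi>) = taylor_coeff (f \<circ> g)" for f
    by (intro HOL.ext taylor_coeff_cong) (simp add: eq)
  moreover have "(f \<circ> \<phi>) holomorphic_on ball 0 1 \<longleftrightarrow> (f \<circ> g) holomorphic_on ball 0 1" for f
    by (rule holomorphic_cong) (simp_all add: eq)
  ultimately show ?thesis
    using bc by (simp add: bounded_composition_def H2_def H2_norm_def)
qed

end
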